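(* The redundancy service system and the FCFS matching queue (with the same customer types, server types, compatibility relation and rates) are equivalent in the sense that the processes $X^r(t)$ and $X^m(t)$ are sample-path equivalent: if the two systems are started with the same customer state $X^r(0)=X^m(0)$, the customer arrival processes of the two systems are coupled to be the same, and, for each server type $s_j$, the potential service completions of server $s_j$ in the redundancy system are coupled with the arrivals of servers of type $s_j$ in the matching queue (one common Poisson process of rate $\mu_{s_j}$), then with probability one $X^r(t)=X^m(t)$ for all $t\ge0$. In particular, for each type of customer, the sojourn time in the system is the same for both models.
   Context: Customer types are $\mathcal{C}=\{c_1,\dots,c_I\}$, server types are $\mathcal{S}=\{s_1,\dots,s_J\}$, and $\mathfrak{E}\subseteq\mathcal{S}\times\mathcal{C}$ is a compatibility relation; $(s_j,c_i)\in\mathfrak{E}$ means $s_j$ can serve $c_i$. Rates $\lambda_{c_i}>0$, $\mu_{s_j}>0$ are given. In both models customers of type $c_i$ arrive in independent Poisson streams of rates $\lambda_{c_i}$. Redundancy service model: there are $J$ servers $s_1,\dots,s_J$, each with its own FCFS queue, with independent exponential service times of rate $\mu_{s_j}$ at $s_j$. An arriving customer of type $c_i$ places a copy in the queue of every server compatible with $c_i$; several servers may process copies of the same customer simultaneously; the customer and all its copies leave when the first copy completes service. Potential service completions of server $s_j$ form a Poisson process of rate $\mu_{s_j}$, independent across servers and of arrivals: at such an instant the customer being served by $s_j$, if any, departs; if $s_j$ is idle nothing changes. $X^r(t)=(c^1,\dots,c^L)$ lists the types of all customers in the system in order of arrival (oldest first). FCFS parallel matching queue: servers of type $s_j$ arrive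 in Poisson streams of rates $\mu_{s_j}$, independent of each other and of the customer arrivals. Customers queue in order of arrival. An arriving server is matched with the longest waiting compatible customer and both leave immediately; if there is none, the server leaves immediately alone. $X^m(t)=(c^1,\dots,c^L)$ lists the types of the customers in the queue in order of arrival (oldest first). The sojourn time of a customer is the time between its arrival and its departure from the system. *)

theory Defs
  imports "HOL-Probability.Probability"
begin

definition poisson_process :: "'w measure \<Rightarrow> real \<Rightarrow> (real \<Rightarrow> 'w \<Rightarrow> nat) \<Rightarrow> bool" where
  "poisson_process M r N \<longleftrightarrow>
     (\<forall>t\<ge>0. N t \<in> measurable M (count_space UNIV)) \<and>
     (AE \<omega> in M. N 0 \<omega> = 0 \<and> mono_on {0..} (\<lambda>t. N t \<omega>) \<and>
        (\<forall>t\<ge>0. continuous (at_right t) (\<lambda>u. N u \<omega>))) \<and>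
     (\<forall>s t. 0 \<le> s \<and> s < t \<longrightarrow>
        distr M (count_space UNIV) (\<lambda>\<omega>. N t \<omega> - N s \<omega>) = measure_pmf (poisson_pmf (r * (t - s)))) \<and>
     (\<forall>n (\<tau> :: nat \<Rightarrow> real). 0 \<le> \<tau> 0 \<and> (\<forall>i<n. \<tau> i \<le> \<tau> (Suc i)) \<longrightarrow>
        prob_space.indep_vars M (\<lambda>_. count_space UNIV)
          (\<lambda>i \<omega>. N (\<tau> (Suc i)) \<omega> - N (\<tau> i) \<omega>) {..<n})"

definition independent_processes :: "'w measure \<Rightarrow> ('e \<Rightarrow> real \<Rightarrow> 'w \<Rightarrow> nat) \<Rightarrow> bool" where
  "independent_processes M N \<longleftrightarrow>
     prob_space.indep_vars M (\<lambda>_. PiM {0..} (\<lambda>_. count_space UNIV))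
       (\<lambda>e \<omega>. \<lambda>t\<in>{0..}. N e t \<omega>) UNIV"

text \<open>
  The streams driving both systems: customer arrivals of each type and, for each server type,
  one stream that is read as the potential service completions of that server in the redundancy
  system and as the arrivals of servers of that type in the matching queue.
\<close>

datatype ('c, 's) source = Customer 'c | Server 's

definition poisson_streams ::
  "'w measure \<Rightarrow> ('c \<Rightarrow> real) \<Rightarrow> ('s \<Rightarrow> real) \<Rightarrow> (('c, 's) source \<Rightarrow> real \<Rightarrow> 'w \<Rightarrow> nat) \<Rightarrow> bool" where
  "poisson_streams M lam mu N \<longleftrightarrow>
     (\<forall>c. poisson_process M (lam c) (N (Customer c))) \<and>
     (\<forall>s. poisson_process M (mu s) (N (Server s))) \<and>
     independent_processes M N"

text \<open>
  Customers carry an identity besides their type, so that copies can be traced and sojourn times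
  compared. \<open>Initial c k\<close> is the customer in position \<open>k\<close> (from \<open>0\<close>) at time \<open>0\<close>;
  \<open>Arrival c m\<close> is the \<open>m\<close>-th (\<open>m \<ge> 1\<close>) customer of type \<open>c\<close> arriving after time \<open>0\<close>.
\<close>

datatype 'c customer = Initial (ctype: 'c) nat | Arrival (ctype: 'c) nat

definition initial_customers :: "'c list \<Rightarrow> 'c customer list" where
  "initial_customers cs = map2 Initial cs [0..<length cs]"

definition single_event :: "('e \<Rightarrow> real \<Rightarrow> nat) \<Rightarrow> real \<Rightarrow> real \<Rightarrow> 'e \<Rightarrow> bool" where
  "single_event n s t e \<longleftrightarrow>
     (\<forall>u\<in>{s..<t}. \<forall>e'. n e' u = n e' s) \<and>
     n e t = Suc (n e s) \<and> (\<forall>e'. e' \<noteq> e \<longrightarrow> n e' t = n e' s)"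

text \<open>
  Here \<open>n\<close> consists of the counting paths of the streams and \<open>step e m\<close> is the effect of the
  \<open>m\<close>-th event of stream \<open>e\<close>. The state is constant over intervals without events, and is
  updated from its value just before \<open>t\<close> when exactly one event occurs at \<open>t\<close>.
  Nothing is prescribed for simultaneous events.
\<close>

definition follows :: "('e \<Rightarrow> real \<Rightarrow> nat) \<Rightarrow> ('e \<Rightarrow> nat \<Rightarrow> 'x \<Rightarrow> 'x) \<Rightarrow> (real \<Rightarrow> 'x) \<Rightarrow> bool" where
  "follows n step x \<longleftrightarrow>
     (\<forall>s t. 0 \<le> s \<and> s < t \<and> (\<forall>u\<in>{s..t}. \<forall>e. n e u = n e s) \<longrightarrow> x t = x s) \<and>
     (\<forall>s t e. 0 \<le> s \<and> s < t \<and> single_event n s t e \<longrightarrow> x t = step e (n e t) (x s))"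

text \<open>
  \<open>present\<close> lists the customers in the system, oldest first; \<open>queue X s\<close> holds the copies at
  server \<open>s\<close>, its head being the copy in service.
\<close>

record ('c, 's) redundancy_state =
  present :: "'c customer list"
  queue :: "'s \<Rightarrow> 'c customer list"

definition redundancy_arrive ::
  "('s \<times> 'c) set \<Rightarrow> 'c customer \<Rightarrow> ('c, 's) redundancy_state \<Rightarrow> ('c, 's) redundancy_state" where
  "redundancy_arrive E k X =
     \<lparr>present = present X @ [k],
      queue = (\<lambda>s. if (s, ctype k) \<in> E then queue X s @ [k] else queue X s)\<rparr>"

definition redundancy_depart ::
  "'c customer \<Rightarrow> ('c, 's) redundancy_state \<Rightarrow> ('c, 's) redundancy_state" where
  "redundancy_depart k X =
     \<lparr>present = removeAll k (present X), queue = (\<lambda>s. removeAll k (queue X s))\<rparr>"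

definition redundancy_complete ::
  "'s \<Rightarrow> ('c, 's) redundancy_state \<Rightarrow> ('c, 's) redundancy_state" where
  "redundancy_complete s X = (case queue X s of [] \<Rightarrow> X | k # _ \<Rightarrow> redundancy_depart k X)"

fun redundancy_step ::
  "('s \<times> 'c) set \<Rightarrow> ('c, 's) source \<Rightarrow> nat \<Rightarrow> ('c, 's) redundancy_state \<Rightarrow> ('c, 's) redundancy_state" where
  "redundancy_step E (Customer c) m X = redundancy_arrive E (Arrival c m) X"
| "redundancy_step E (Server s) m X = redundancy_complete s X"

text \<open>The initial customers have joined an empty system one after the other.\<close>

definition redundancy_start :: "('s \<times> 'c) set \<Rightarrow> 'c list \<Rightarrow> ('c, 's) redundancy_state" where
  "redundancy_start E cs =
     fold (redundancy_arrive E) (initial_customers cs) \<lparr>present = [], queue = (\<lambda>_. [])\<rparr>"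

definition redundancy_types :: "('c, 's) redundancy_state \<Rightarrow> 'c list" where
  "redundancy_types X = map ctype (present X)"

definition redundancy_system ::
  "'w measure \<Rightarrow> ('s \<times> 'c) set \<Rightarrow> (('c, 's) source \<Rightarrow> real \<Rightarrow> 'w \<Rightarrow> nat) \<Rightarrow>
   (real \<Rightarrow> 'w \<Rightarrow> ('c, 's) redundancy_state) \<Rightarrow> bool" where
  "redundancy_system M E N R \<longleftrightarrow>
     (AE \<omega> in M. R 0 \<omega> = redundancy_start E (redundancy_types (R 0 \<omega>)) \<and>
        follows (\<lambda>e t. N e t \<omega>) (redundancy_step E) (\<lambda>t. R t \<omega>))"

definition matching_serve :: "('s \<times> 'c) set \<Rightarrow> 's \<Rightarrow> 'c customer list \<Rightarrow> 'c customer list" where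
  "matching_serve E s Q =
     (case find (\<lambda>k. (s, ctype k) \<in> E) Q of None \<Rightarrow> Q | Some k \<Rightarrow> remove1 k Q)"

fun matching_step ::
  "('s \<times> 'c) set \<Rightarrow> ('c, 's) source \<Rightarrow> nat \<Rightarrow> 'c customer list \<Rightarrow> 'c customer list" where
  "matching_step E (Customer c) m Q = Q @ [Arrival c m]"
| "matching_step E (Server s) m Q = matching_serve E s Q"

definition matching_types :: "'c customer list \<Rightarrow> 'c list" where
  "matching_types Q = map ctype Q"

definition matching_queue ::
  "'w measure \<Rightarrow> ('s \<times> 'c) set \<Rightarrow> (('c, 's) source \<Rightarrow> real \<Rightarrow> 'w \<Rightarrow> nat) \<Rightarrow>
   (real \<Rightarrow> 'w \<Rightarrow> 'c customer list) \<Rightarrow> bool" where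
  "matching_queue M E N Q \<longleftrightarrow>
     (AE \<omega> in M. Q 0 \<omega> = initial_customers (matching_types (Q 0 \<omega>)) \<and>
        follows (\<lambda>e t. N e t \<omega>) (matching_step E) (\<lambda>t. Q t \<omega>))"

text \<open>
  Times are extended reals: a customer who never departs has sojourn time \<open>\<infinity>\<close>.
  The sojourn time of a customer present at time \<open>0\<close> is counted from time \<open>0\<close>.
\<close>

fun arrival_time :: "(('c, 's) source \<Rightarrow> real \<Rightarrow> nat) \<Rightarrow> 'c customer \<Rightarrow> ereal" where
  "arrival_time n (Initial c k) = 0"
| "arrival_time n (Arrival c m) = Inf {ereal t |t. 0 \<le> t \<and> m \<le> n (Customer c) t}"

text \<open>\<open>p t\<close> is the set of customers in the system at time \<open>t\<close>.\<close>

definition departure_time ::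
  "(('c, 's) source \<Rightarrow> real \<Rightarrow> nat) \<Rightarrow> (real \<Rightarrow> 'c customer set) \<Rightarrow> 'c customer \<Rightarrow> ereal" where
  "departure_time n p k = Inf {ereal t |t. arrival_time n k \<le> ereal t \<and> k \<notin> p t}"

definition sojourn_time ::
  "(('c, 's) source \<Rightarrow> real \<Rightarrow> nat) \<Rightarrow> (real \<Rightarrow> 'c customer set) \<Rightarrow> 'c customer \<Rightarrow> ereal" where
  "sojourn_time n p k = departure_time n p k - arrival_time n k"

end

theory Submission
  imports Defs
begin

text \<open>
  The copies queued at a server are the compatible customers in the system, in order of arrival,
  so the copy in service is the longest waiting compatible customer: completions and matches
  remove the same customer. This is an invariant of single events. It extends to all times because
  almost surely every \<open>[0, T]\<close> is cut by some uniform grid into cells with at most one event each: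
  a cell of length \<open>h\<close> fails with probability \<open>O(h\<^sup>2)\<close>, hence some cell of the grid with mesh
  \<open>T / K\<close> fails with probability \<open>O(1 / K)\<close>.
\<close>

section \<open>Almost sure separation of events\<close>

text \<open>Only the values at the two ends of the cell enter, so the condition concerns one
  increment per stream. Subtraction is that of \<open>nat\<close>: for monotone paths the
  differences count the events in \<open>(s, t]\<close>, and a zero difference makes the path
  constant on the cell.\<close>

definition at_most_one_event :: "('e \<Rightarrow> real \<Rightarrow> nat) \<Rightarrow> real \<Rightarrow> real \<Rightarrow> bool" where
  "at_most_one_event n s t \<longleftrightarrow>
     (\<forall>e. n e t - n e s \<le> 1) \<and>
     (\<forall>e e'. e \<noteq> e' \<longrightarrow> n e t - n e s = 0 \<or> n e' t - n e' s = 0)"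

lemma at_most_one_eventD:
  assumes "at_most_one_event n s t" "e \<noteq> e'"
  shows "n e t - n e s = 0 \<or> n e' t - n e' s = 0"
  using assms unfolding at_most_one_event_def by metis

section \<open>Tails and independence of Poisson increments\<close>

lemma poisson_pmf_ge_1:
  assumes "x > 0"
  shows "measure_pmf.prob (poisson_pmf x) {1..} \<le> x"
proof -
  have "{1..} = UNIV - {0::nat}"
    by auto
  then have "measure_pmf.prob (poisson_pmf x) {1..} = 1 - measure_pmf.prob (poisson_pmf x) {0}"
    using measure_pmf.prob_compl[of "{0::nat}" "poisson_pmf x"] by simp
  also have "\<dots> = 1 - exp (- x)"
    using assms by (simp add: measure_pmf_single)
  also have "\<dots> \<le> x"
    using exp_ge_add_one_self[of "- x"] by simp
  finally show ?thesis .
qed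

text \<open>The mass of \<open>{0, 1}\<close> is \<open>(1 + x) * exp (- x)\<close>, which is at
  least \<open>(1 + x) * (1 - x)\<close>. The order two in \<open>x\<close> is what makes the bounds
  for all cells of a grid sum to something that vanishes with the mesh.\<close>

lemma poisson_pmf_ge_2:
  assumes "x > 0"
  shows "measure_pmf.prob (poisson_pmf x) {2..} \<le> x\<^sup>2"
proof -
  have "{2..} = UNIV - {0, 1::nat}"
    by auto
  then have "measure_pmf.prob (poisson_pmf x) {2..} = 1 - measure_pmf.prob (poisson_pmf x) {0, 1}"
    using measure_pmf.prob_compl[of "{0, 1::nat}" "poisson_pmf x"] by simp
  also have "\<dots> = 1 - (1 + x) * exp (- x)"
    using assms by (simp add: measure_measure_pmf_finite algebra_simps)
  also have "\<dots> \<le> 1 - (1 + x) * (1 - x)"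
    using exp_ge_add_one_self[of "- x"] assms by (intro diff_left_mono mult_left_mono) auto
  also have "\<dots> = x\<^sup>2"
    by (simp add: algebra_simps power2_eq_square)
  finally show ?thesis .
qed

lemma poisson_process_increment_measurable:
  assumes "poisson_process M r N" "0 \<le> s" "s < t"
  shows "(\<lambda>\<omega>. N t \<omega> - N s \<omega>) \<in> measurable M (count_space UNIV)"
proof -
  have [measurable]: "N t \<in> measurable M (count_space UNIV)" "N s \<in> measurable M (count_space UNIV)"
    using assms by (auto simp: poisson_process_def)
  show ?thesis
    by measurable
qed

lemma poisson_process_increment_prob:
  assumes "poisson_process M r N" "0 \<le> s" "s < t"
  shows "measure M {\<omega> \<in> space M. k \<le> N t \<omega> - N s \<omega>} =
    measure_pmf.prob (poisson_pmf (r * (t - s))) {k..}"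
proof -
  have "measure_pmf.prob (poisson_pmf (r * (t - s))) {k..} =
      measure (distr M (count_space UNIV) (\<lambda>\<omega>. N t \<omega> - N s \<omega>)) {k..}"
    using assms by (simp add: poisson_process_def)
  also have "\<dots> = measure M ((\<lambda>\<omega>. N t \<omega> - N s \<omega>) -` {k..} \<inter> space M)"
    using poisson_process_increment_measurable[OF assms] by (rule measure_distr) simp
  also have "(\<lambda>\<omega>. N t \<omega> - N s \<omega>) -` {k..} \<inter> space M = {\<omega> \<in> space M. k \<le> N t \<omega> - N s \<omega>}"
    by auto
  finally show ?thesis ..
qed

text \<open>Independence is assumed for whole paths, as points of a product space. An increment
  depends only on the coordinates \<open>s\<close> and \<open>t\<close>, so a lower bound on it is a
  measurable condition on the path.\<close>

lemma independent_processes_increments: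
  fixes N :: "'e \<Rightarrow> real \<Rightarrow> 'w \<Rightarrow> nat"
  assumes "prob_space M" "independent_processes M N" "0 \<le> s" "s < t" "e \<noteq> e'"
  shows "measure M {\<omega> \<in> space M. k \<le> N e t \<omega> - N e s \<omega> \<and> k' \<le> N e' t \<omega> - N e' s \<omega>} =
    measure M {\<omega> \<in> space M. k \<le> N e t \<omega> - N e s \<omega>} *
    measure M {\<omega> \<in> space M. k' \<le> N e' t \<omega> - N e' s \<omega>}"
proof -
  interpret prob_space M by fact
  define P where "P = PiM {0::real..} (\<lambda>_. count_space (UNIV :: nat set))"
  define X where "X e \<omega> = (\<lambda>t\<in>{0..}. N e t \<omega>)" for e \<omega>
  define A where "A k = {f \<in> space P. k \<le> f t - f s}" for k
  have indep: "indep_vars (\<lambda>_. P) X UNIV"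
    using assms(2) unfolding independent_processes_def P_def X_def .
  have X: "X e \<omega> \<in> space P" for e \<omega>
    by (simp add: X_def P_def space_PiM)
  have [measurable]: "(\<lambda>f. f t) \<in> measurable P (count_space UNIV)"
    "(\<lambda>f. f s) \<in> measurable P (count_space UNIV)"
    unfolding P_def using assms by (auto intro!: measurable_component_singleton)
  have A: "A k \<in> sets P" for k
    unfolding A_def by measurable
  \<comment> \<open>Both \<open>s\<close> and \<open>t\<close> are nonnegative, so the restricted
    path takes the values of \<open>N e\<close> there and not \<open>undefined\<close>.\<close>
  have preimage: "X e -` A k \<inter> space M = {\<omega> \<in> space M. k \<le> N e t \<omega> - N e s \<omega>}" for e k
    using X assms by (auto simp: A_def) (auto simp: X_def)
  have "prob (\<Inter>i\<in>{e, e'}. X i -` A (if i = e then k else k') \<inter> space M) =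
      (\<Prod>i\<in>{e, e'}. prob (X i -` A (if i = e then k else k') \<inter> space M))"
    by (rule indep_varsD[OF indep]) (auto simp: A)
  then have "prob ((X e -` A k \<inter> space M) \<inter> (X e' -` A k' \<inter> space M)) =
      prob (X e -` A k \<inter> space M) * prob (X e' -` A k' \<inter> space M)"
    using assms(5) by simp
  moreover have "(X e -` A k \<inter> space M) \<inter> (X e' -` A k' \<inter> space M) =
      {\<omega> \<in> space M. k \<le> N e t \<omega> - N e s \<omega> \<and> k' \<le> N e' t \<omega> - N e' s \<omega>}"
    by (auto simp: preimage)
  ultimately show ?thesis
    by (simp add: preimage)
qed

text \<open>A union bound over ordered pairs of streams: the pair \<open>(e, e')\<close> contributes
  at most \<open>r e * r e' * (t - s)\<^sup>2\<close>, and the products of rates sum to the square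
  of the total rate.\<close>

lemma several_events_prob:
  fixes N :: "'e \<Rightarrow> real \<Rightarrow> 'w \<Rightarrow> nat"
  assumes "prob_space M" "finite (UNIV :: 'e set)"
    and N: "\<And>e. poisson_process M (r e) (N e)" and r: "\<And>e. r e > 0"
    and "independent_processes M N" and st: "0 \<le> s" "s < t"
  shows "{\<omega> \<in> space M. \<not> at_most_one_event (\<lambda>e t. N e t \<omega>) s t} \<in> sets M" (is "?B \<in> _")
    and "measure M {\<omega> \<in> space M. \<not> at_most_one_event (\<lambda>e t. N e t \<omega>) s t} \<le>
      (\<Sum>e\<in>UNIV. r e)\<^sup>2 * (t - s)\<^sup>2"
proof -
  interpret prob_space M by fact
  \<comment> \<open>Diagonal pairs stand for two events of one stream, the other pairs for an event
    in each of two streams.\<close>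
  define A where "A = (\<lambda>(e, e'). if e = e' then {\<omega> \<in> space M. 2 \<le> N e t \<omega> - N e s \<omega>}
    else {\<omega> \<in> space M. 1 \<le> N e t \<omega> - N e s \<omega> \<and> 1 \<le> N e' t \<omega> - N e' s \<omega>})"
  have [measurable]: "(\<lambda>\<omega>. N e t \<omega> - N e s \<omega>) \<in> measurable M (count_space UNIV)" for e
    using poisson_process_increment_measurable[OF N st] .
  have A_sets: "A p \<in> events" for p
    unfolding A_def by (cases p) simp
  have B: "?B = (\<Union>p\<in>UNIV. A p)"
  proof (intro equalityI subsetI)
    fix \<omega> assume \<omega>: "\<omega> \<in> ?B"
    show "\<omega> \<in> (\<Union>p\<in>UNIV. A p)"
    proof (cases "\<exists>e. 2 \<le> N e t \<omega> - N e s \<omega>")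
      case True
      then obtain e where "2 \<le> N e t \<omega> - N e s \<omega>" ..
      then have "\<omega> \<in> A (e, e)"
        using \<omega> by (simp add: A_def)
      then show ?thesis
        by blast
    next
      case False
      then have "N e t \<omega> - N e s \<omega> \<le> 1" for e
        by (metis not_less_eq_eq Suc_1)
      then obtain e e' where e: "e \<noteq> e'" "N e t \<omega> - N e s \<omega> \<noteq> 0" "N e' t \<omega> - N e' s \<omega> \<noteq> 0"
        using \<omega> unfolding at_most_one_event_def by blast
      then have "\<omega> \<in> A (e, e')"
        using \<omega> by (simp add: A_def Suc_le_eq)
      then show ?thesis
        by blast
    qed
  next
    fix \<omega> assume "\<omega> \<in> (\<Union>p\<in>UNIV. A p)"
    then obtain e e' where \<omega>: "\<omega> \<in> A (e, e')"
      by auto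
    show "\<omega> \<in> ?B"
    proof (cases "e = e'")
      case True
      then have "\<omega> \<in> space M" "\<not> N e t \<omega> - N e s \<omega> \<le> 1"
        using \<omega> by (auto simp: A_def)
      then show ?thesis
        unfolding at_most_one_event_def by blast
    next
      case False
      then have "\<omega> \<in> space M" "N e t \<omega> - N e s \<omega> \<noteq> 0" "N e' t \<omega> - N e' s \<omega> \<noteq> 0"
        using \<omega> by (auto simp: A_def)
      then show ?thesis
        using at_most_one_eventD[OF _ False, of "\<lambda>e t. N e t \<omega>" s t] by auto
    qed
  qed
  have fin: "finite (UNIV :: ('e \<times> 'e) set)"
    using assms(2) by (simp add: finite_prod)
  show "?B \<in> events"
    unfolding B using fin A_sets by blast
  \<comment> \<open>On the diagonal this is the quadratic Poisson tail; off the diagonal,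
    independence gives a product of two linear tails.\<close>
  have A_prob: "prob (A (e, e')) \<le> r e * r e' * (t - s)\<^sup>2" for e e'
  proof (cases "e = e'")
    case True
    then show ?thesis
      using poisson_process_increment_prob[OF N st, of 2 e] poisson_pmf_ge_2[of "r e * (t - s)"] r st
      by (simp add: A_def power2_eq_square ac_simps)
  next
    case False
    have le: "prob {\<omega> \<in> space M. 1 \<le> N e t \<omega> - N e s \<omega>} \<le> r e * (t - s)" for e
      using poisson_process_increment_prob[OF N st, of 1 e] poisson_pmf_ge_1[of "r e * (t - s)"] r st
      by simp
    have "prob (A (e, e')) \<le> (r e * (t - s)) * (r e' * (t - s))"
      unfolding A_def using False
        independent_processes_increments[OF assms(1,5) st False, of 1 1] le[of e] le[of e'] r[of e] st
      by (simp add: mult_mono)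
    then show ?thesis
      by (simp add: power2_eq_square ac_simps)
  qed
  have "prob ?B \<le> (\<Sum>p\<in>UNIV. prob (A p))"
    unfolding B using fin A_sets by (intro finite_measure_subadditive_finite) auto
  also have "\<dots> \<le> (\<Sum>(e, e')\<in>UNIV. r e * r e' * (t - s)\<^sup>2)"
    using A_prob by (intro sum_mono) auto
  also have "\<dots> = (\<Sum>e\<in>UNIV. r e)\<^sup>2 * (t - s)\<^sup>2"
    unfolding power2_eq_square sum_product sum.cartesian_product UNIV_Times_UNIV
    by (simp add: case_prod_beta sum_distrib_right)
  finally show "prob ?B \<le> (\<Sum>e\<in>UNIV. r e)\<^sup>2 * (t - s)\<^sup>2" .
qed

text \<open>One good mesh suffices, so the exceptional event is the intersection of all
  \<open>D K\<close>. Its probability is at most that of each \<open>D K\<close>, and the bounds on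
  these tend to \<open>0\<close>.\<close>

lemma AE_grid_separates_events:
  fixes N :: "'e \<Rightarrow> real \<Rightarrow> 'w \<Rightarrow> nat"
  assumes "prob_space M" "finite (UNIV :: 'e set)"
    and N: "\<And>e. poisson_process M (r e) (N e)" and r: "\<And>e. r e > 0"
    and "independent_processes M N" and "T > 0"
  shows "AE \<omega> in M. \<exists>h K. h > 0 \<and> real K * h = T \<and>
    (\<forall>i<K. at_most_one_event (\<lambda>e t. N e t \<omega>) (real i * h) (real (Suc i) * h))"
proof -
  interpret prob_space M by fact
  \<comment> \<open>Grid \<open>K\<close> has \<open>Suc K\<close> cells, which keeps the mesh
    positive at \<open>K = 0\<close>.\<close>
  define h where "h K = T / real (Suc K)" for K
  define B where "B s t = {\<omega> \<in> space M. \<not> at_most_one_event (\<lambda>e t. N e t \<omega>) s t}" for s t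
  define D where "D K = (\<Union>i<Suc K. B (real i * h K) (real (Suc i) * h K))" for K
  define C where "C = (\<Sum>e\<in>UNIV. r e)\<^sup>2 * T\<^sup>2"
  have h: "h K > 0" "real (Suc K) * h K = T" for K
    using assms(6) by (auto simp: h_def field_simps)
  have cell: "0 \<le> real i * h K" "real i * h K < real (Suc i) * h K" for i K
    using h(1)[of K] by (auto simp: algebra_simps)
  note B = several_events_prob[OF assms(1-2) N r assms(5), folded B_def]
  have D_sets: "D K \<in> events" for K
    unfolding D_def using B(1)[OF cell] by blast
  have D_prob: "prob (D K) \<le> C / real (Suc K)" for K
  proof -
    have "prob (D K) \<le> (\<Sum>i<Suc K. prob (B (real i * h K) (real (Suc i) * h K)))"
      unfolding D_def using B(1)[OF cell] by (intro finite_measure_subadditive_finite) auto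
    also have "\<dots> \<le> (\<Sum>i<Suc K. (\<Sum>e\<in>UNIV. r e)\<^sup>2 * (h K)\<^sup>2)"
    proof (rule sum_mono)
      fix i
      show "prob (B (real i * h K) (real (Suc i) * h K)) \<le> (\<Sum>e\<in>UNIV. r e)\<^sup>2 * (h K)\<^sup>2"
        using B(2)[OF cell, of i K] by (simp add: algebra_simps)
    qed
    \<comment> \<open>There are \<open>Suc K\<close> cells, each with squared length
      \<open>T\<^sup>2 / (Suc K)\<^sup>2\<close>, so one factor \<open>Suc K\<close> stays in the
      denominator.\<close>
    also have "\<dots> = C / real (Suc K)"
      by (simp add: C_def h_def power2_eq_square field_simps del: of_nat_Suc)
    finally show ?thesis .
  qed
  have "prob (\<Inter>K. D K) \<le> C / real (Suc K)" for K
  proof -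
    have "prob (\<Inter>K. D K) \<le> prob (D K)"
      using D_sets by (intro finite_measure_mono) auto
    then show ?thesis
      using D_prob[of K] by linarith
  qed
  moreover have "(\<lambda>K. C / real (Suc K)) \<longlonglongrightarrow> 0"
    using LIMSEQ_Suc[OF lim_const_over_n[of C]] .
  ultimately have "prob (\<Inter>K. D K) \<le> 0"
    by (intro LIMSEQ_le_const[of _ 0]) auto
  then have "(\<Inter>K. D K) \<in> null_sets M"
    using D_sets by (auto simp: null_sets_def emeasure_eq_measure measure_le_0_iff)
  then have "AE \<omega> in M. \<omega> \<notin> (\<Inter>K. D K)"
    by (rule AE_not_in)
  then show ?thesis
  proof (rule AE_mp, intro AE_I2 impI)
    fix \<omega> assume \<omega>: "\<omega> \<in> space M" "\<omega> \<notin> (\<Inter>K. D K)"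
    then obtain K where "\<omega> \<notin> D K"
      by auto
    with \<omega> have "\<forall>i<Suc K. at_most_one_event (\<lambda>e t. N e t \<omega>) (real i * h K) (real (Suc i) * h K)"
      unfolding D_def B_def by blast
    then show "\<exists>h K. h > 0 \<and> real K * h = T \<and>
        (\<forall>i<K. at_most_one_event (\<lambda>e t. N e t \<omega>) (real i * h) (real (Suc i) * h))"
      using h by blast
  qed
qed

section \<open>Invariants of driven systems\<close>

text \<open>The jump time is the infimum of the times at which the final value has been reached.
  Right continuity shows that this value is attained at the infimum itself.\<close>

lemma counting_path_first_jump:
  fixes f :: "real \<Rightarrow> nat"
  assumes mono: "mono_on {0..} f" and right: "\<And>u. u \<ge> 0 \<Longrightarrow> continuous (at_right u) f"
    and st: "0 \<le> s" "s \<le> t" and jump: "f t = Suc (f s)"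
  obtains v where "s < v" "v \<le> t" "\<And>u. s \<le> u \<Longrightarrow> u < v \<Longrightarrow> f u = f s"
    "\<And>u. v \<le> u \<Longrightarrow> u \<le> t \<Longrightarrow> f u = f t"
proof -
  define S where "S = {u. s \<le> u \<and> f u \<ge> f t}"
  define v where "v = Inf S"
  have mono': "f x \<le> f y" if "0 \<le> x" "x \<le> y" for x y
    using monotone_onD[OF mono] that by auto
  have S: "t \<in> S" "bdd_below S"
    using st by (auto simp: S_def intro: bdd_belowI)
  have v: "s \<le> v" "v \<le> t"
    unfolding v_def using S by (auto intro!: cInf_greatest cInf_lower simp: S_def)
  \<comment> \<open>Since \<open>nat\<close> is discrete, convergence from the right means equality
    on some interval to the right of \<open>v\<close>.\<close>
  have "\<forall>\<^sub>F u in at_right v. f u = f v"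
    using right[of v] v st by (simp add: continuous_within tendsto_discrete)
  then obtain b where b: "v < b" "\<And>u. v < u \<Longrightarrow> u < b \<Longrightarrow> f u = f v"
    by (auto simp: eventually_at_right_field)
  \<comment> \<open>Such a \<open>u\<close> exists because \<open>b\<close> exceeds the infimum of
    \<open>S\<close>; it is \<open>v\<close> itself or lies where \<open>f\<close> equals
    \<open>f v\<close>.\<close>
  obtain u where u: "u \<in> S" "u < b"
    using cInf_lessD[of S b] S b(1) unfolding v_def by auto
  have "v \<le> u"
    unfolding v_def using u S by (auto intro: cInf_lower)
  then have fv: "f v \<ge> f t"
    using b(2)[of u] u by (cases "u = v") (auto simp: S_def)
  show thesis
  proof
    show "s < v" "v \<le> t"
      using fv jump v by (auto intro: le_neq_trans)
    show "f u = f s" if "s \<le> u" "u < v" for u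
    proof -
      have "u \<notin> S"
        using that cInf_lower[OF _ S(2), of u] by (auto simp: v_def)
      then show ?thesis
        using that jump mono'[of s u] st by (auto simp: S_def)
    qed
    show "f u = f t" if "v \<le> u" "u \<le> t" for u
      using mono'[of v u] mono'[of u t] that fv v st by auto
  qed
qed

text \<open>At most one stream moves, and it jumps once, at \<open>v\<close>. The first clause of
  \<open>follows\<close> freezes the state before and after \<open>v\<close>; the second applies
  \<open>step\<close> at \<open>v\<close>. The invariant also sees the counters because the identity
  of an arriving customer is read off its stream's counter.\<close>

lemma follows_invariant_cell:
  fixes n :: "'e \<Rightarrow> real \<Rightarrow> nat"
  assumes follows: "follows n step x"
    and mono: "\<And>e. mono_on {0..} (n e)"
    and right: "\<And>e u. u \<ge> 0 \<Longrightarrow> continuous (at_right u) (n e)"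
    and step: "\<And>c e y. I c y \<Longrightarrow> I (c(e := Suc (c e))) (step e (Suc (c e)) y)"
    and cell: "at_most_one_event n s t" "0 \<le> s"
    and I: "I (\<lambda>e. n e s) (x s)" and u: "s \<le> u" "u \<le> t"
  shows "I (\<lambda>e. n e u) (x u)"
proof -
  have mono': "n e a \<le> n e b" if "0 \<le> a" "a \<le> b" for e a b
    using monotone_onD[OF mono[of e]] that by auto
  \<comment> \<open>A vanishing difference on \<open>nat\<close> only says
    \<open>n e t \<le> n e s\<close>; monotonicity turns this into constancy.\<close>
  have const: "n e w = n e s" if "n e t - n e s = 0" "s \<le> w" "w \<le> t" for e w
    using that mono'[of s w e] mono'[of w t e] cell(2) by auto
  have stay: "x b = x a" if "0 \<le> a" "a \<le> b" "\<And>w e. a \<le> w \<Longrightarrow> w \<le> b \<Longrightarrow> n e w = n e a" for a b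
  proof (cases "a = b")
    case False
    then show ?thesis
      using follows that unfolding follows_def by (metis atLeastAtMost_iff order.not_eq_order_implies_strict)
  qed simp
  show ?thesis
  proof (cases "\<forall>e. n e t - n e s = 0")
    case True
    then have same: "n e w = n e s" if "s \<le> w" "w \<le> u" for e w
      using True that u by (intro const) auto
    have "x u = x s"
      by (intro stay same cell(2) u)
    moreover have "(\<lambda>e. n e u) = (\<lambda>e. n e s)"
      using u by (intro ext same) auto
    ultimately show ?thesis
      using I by simp
  next
    case False
    then obtain e where e: "n e t - n e s \<noteq> 0"
      by auto
    then have "n e t = Suc (n e s)"
      using cell(1) by (auto simp: at_most_one_event_def dest!: spec[of _ e])
    then obtain v where v: "s < v" "v \<le> t" and before: "\<And>w. s \<le> w \<Longrightarrow> w < v \<Longrightarrow> n e w = n e s"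
      and after: "\<And>w. v \<le> w \<Longrightarrow> w \<le> t \<Longrightarrow> n e w = Suc (n e s)"
      using counting_path_first_jump[OF mono right, of s t e] cell(2) u by (metis order_trans)
    have other: "n e' w = n e' s" if "e' \<noteq> e" "s \<le> w" "w \<le> t" for e' w
    proof (rule const)
      show "n e' t - n e' s = 0"
        using at_most_one_eventD[OF cell(1) that(1)] e by blast
    qed (use that in auto)
    show ?thesis
    proof (cases "u < v")
      case True
      then have same: "n e' w = n e' s" if "s \<le> w" "w \<le> u" for e' w
        using other[of e' w] before[of w] that u by (cases "e' = e") auto
      have "x u = x s"
        by (intro stay same cell(2) u)
      moreover have "(\<lambda>e. n e u) = (\<lambda>e. n e s)"
        using u by (intro ext same) auto
      ultimately show ?thesis
        using I by simp
    next
      case False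
      have before': "n e' w = n e' s" if "s \<le> w" "w < v" for e' w
        using other[of e' w] before[of w] that v by (cases "e' = e") auto
      \<comment> \<open>By \<open>other\<close>, no second stream jumps at \<open>v\<close>, so the
        case on which \<open>follows\<close> is silent does not occur.\<close>
      have "single_event n s v e"
        using before' after[of v] other[of _ v] v unfolding single_event_def
        by (metis atLeastLessThan_iff less_imp_le order_refl)
      then have "x v = step e (n e v) (x s)"
        using follows v cell(2) unfolding follows_def by blast
      moreover have later: "n e' w = n e' v" if "v \<le> w" "w \<le> u" for e' w
        using after[of w] after[of v] other[of e' w] other[of e' v] that v u
        by (cases "e' = e") auto
      have "x u = x v"
        using False v cell(2) by (intro stay later) auto
      moreover have "(\<lambda>e'. n e' u) = (\<lambda>e'. n e' s)(e := Suc (n e s))"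
        using after[of u] other[of _ u] False u by auto
      ultimately show ?thesis
        using step[OF I, of e] after[of v] v by simp
    qed
  qed
qed

lemma follows_invariant:
  fixes n :: "'e \<Rightarrow> real \<Rightarrow> nat"
  assumes follows: "follows n step x"
    and mono: "\<And>e. mono_on {0..} (n e)"
    and right: "\<And>e u. u \<ge> 0 \<Longrightarrow> continuous (at_right u) (n e)"
    and step: "\<And>c e y. I c y \<Longrightarrow> I (c(e := Suc (c e))) (step e (Suc (c e)) y)"
    and h: "h > 0"
    and grid: "\<And>i. i < K \<Longrightarrow> at_most_one_event n (real i * h) (real (Suc i) * h)"
    and I: "I (\<lambda>e. n e 0) (x 0)" and t: "0 \<le> t" "t \<le> real K * h"
  shows "I (\<lambda>e. n e t) (x t)"
proof -
  \<comment> \<open>The claim covers every time up to the \<open>k\<close>-th grid point; taken at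
    that point it starts the next cell.\<close>
  have "\<forall>t. 0 \<le> t \<and> t \<le> real k * h \<longrightarrow> I (\<lambda>e. n e t) (x t)" if "k \<le> K" for k
    using that
  proof (induction k)
    case 0
    then show ?case
      using I by auto
  next
    case (Suc k)
    show ?case
    proof (intro allI impI)
      fix t assume t: "0 \<le> t \<and> t \<le> real (Suc k) * h"
      show "I (\<lambda>e. n e t) (x t)"
      proof (cases "t \<le> real k * h")
        case True
        then show ?thesis
          using Suc t by simp
      next
        case False
        have "I (\<lambda>e. n e (real k * h)) (x (real k * h))"
          using Suc h by simp
        then show ?thesis
          using follows_invariant_cell[where n = n and x = x and I = I and s = "real k * h"
              and t = "real (Suc k) * h" and u = t, OF follows mono right step grid]
            Suc.prems False t h
          by simp
      qed
    qed
  qed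
  then show ?thesis
    using t by blast
qed

lemma follows_const:
  assumes "follows n step x" "0 \<le> s" "s < t" "\<forall>u\<in>{s..t}. \<forall>e. n e u = n e s"
  shows "x t = x s"
  using assms(1)[unfolded follows_def, THEN conjunct1, rule_format, of s t] assms(2-4) by metis

lemma follows_single_event:
  assumes "follows n step x" "0 \<le> s" "s < t" "single_event n s t e"
  shows "x t = step e (n e t) (x s)"
  using assms(1)[unfolded follows_def, THEN conjunct2, rule_format, of s t e] assms(2-4) by metis

text \<open>Both systems read the same counting paths, so the pair is again a driven system and a
  relation between the two states can be treated as an invariant.\<close>

lemma follows_pair:
  assumes x: "follows n f x" and y: "follows n g y"
  shows "follows n (\<lambda>e m. map_prod (f e m) (g e m)) (\<lambda>t. (x t, y t))"
  unfolding follows_def map_prod_simp prod.inject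
proof (intro conjI allI impI; elim conjE)
  fix s t
  assume *: "0 \<le> s" "s < t" "\<forall>u\<in>{s..t}. \<forall>e. n e u = n e s"
  show "x t = x s" "y t = y s"
    using follows_const[OF x *] follows_const[OF y *] by this
next
  fix s t e
  assume *: "0 \<le> s" "s < t" "single_event n s t e"
  show "x t = f e (n e t) (x s)" "y t = g e (n e t) (y s)"
    using follows_single_event[OF x *] follows_single_event[OF y *] by this
qed

section \<open>The coupling\<close>

text \<open>Bounds the arrival indices given out so far. The next arrival of type \<open>i\<close>
  has index \<open>Suc (c (Customer i))\<close>, violates the bound and is therefore new.\<close>

fun known_customer :: "(('c, 's) source \<Rightarrow> nat) \<Rightarrow> 'c customer \<Rightarrow> bool" where
  "known_customer c (Initial i k) = True"
| "known_customer c (Arrival i m) = (m \<le> c (Customer i))"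

text \<open>
  Distinctness makes \<open>removeAll\<close> and \<open>remove1\<close> agree; it persists because the index of an arriving
  customer exceeds those of all earlier customers of its type.
\<close>

definition coupled ::
  "('s \<times> 'c) set \<Rightarrow> (('c, 's) source \<Rightarrow> nat) \<Rightarrow>
   ('c, 's) redundancy_state \<times> 'c customer list \<Rightarrow> bool" where
  "coupled E c = (\<lambda>(X, Q). present X = Q \<and>
     (\<forall>s. queue X s = filter (\<lambda>k. (s, ctype k) \<in> E) Q) \<and>
     distinct Q \<and> (\<forall>k\<in>set Q. known_customer c k))"

lemma known_customer_mono:
  assumes "known_customer c k" "\<And>e. c e \<le> d e"
  shows "known_customer d k"
  using assms by (cases k) (auto intro: order_trans)

text \<open>An arrival is appended to both lists and to exactly the compatible queues. At a service
  event, the head of the filtered queue is the customer that \<open>find\<close> returns, and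
  deleting that customer commutes with filtering.\<close>

lemma coupled_step:
  assumes "coupled E c (X, Q)"
  shows "coupled E (c(e := Suc (c e)))
    (redundancy_step E e (Suc (c e)) X, matching_step E e (Suc (c e)) Q)"
proof -
  have X: "present X = Q" "\<And>s. queue X s = filter (\<lambda>k. (s, ctype k) \<in> E) Q"
    and Q: "distinct Q" "\<And>k. k \<in> set Q \<Longrightarrow> known_customer c k"
    using assms by (auto simp: coupled_def)
  have known: "known_customer (c(e := Suc (c e))) k" if "k \<in> set Q" for k
    using Q(2)[OF that] by (rule known_customer_mono) simp
  show ?thesis
  proof (cases e)
    case (Customer i)
    have "Arrival i (Suc (c e)) \<notin> set Q"
      using Q(2)[of "Arrival i (Suc (c e))"] Customer by auto
    then show ?thesis
      using X Q(1) known Customer by (auto simp: coupled_def redundancy_arrive_def)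
  next
    case (Server s)
    show ?thesis
    proof (cases "find (\<lambda>k. (s, ctype k) \<in> E) Q")
      case None
      \<comment> \<open>No compatible customer: the server idles in one system and leaves alone in
        the other, so neither state changes.\<close>
      then have "queue X s = []"
        by (simp add: X find_None_iff filter_empty_conv)
      then show ?thesis
        using X Q known Server None
        by (auto simp: coupled_def redundancy_complete_def matching_serve_def)
    next
      case (Some k)
      then have "\<exists>ks. queue X s = k # ks"
        unfolding X by (induction Q) (auto split: if_splits)
      then show ?thesis
        using X Q(1) known Server Some
        by (auto simp: coupled_def redundancy_complete_def matching_serve_def redundancy_depart_def
          distinct_remove1_removeAll removeAll_filter_not_eq filter_filter conj_commute)
    qed
  qed
qed

lemma fold_redundancy_arrive:
  "present (fold (redundancy_arrive E) ks X) = present X @ ks"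
  "queue (fold (redundancy_arrive E) ks X) s = queue X s @ filter (\<lambda>k. (s, ctype k) \<in> E) ks"
  by (induction ks arbitrary: X) (auto simp: redundancy_arrive_def)

text \<open>Initial customers are distinct by their positions. The counters are arbitrary, since
  initial customers are known for every \<open>c\<close>.\<close>

lemma coupled_start: "coupled E c (redundancy_start E cs, initial_customers cs)"
proof -
  have "distinct (initial_customers cs)"
    by (auto simp: initial_customers_def distinct_conv_nth)
  moreover have "known_customer c k" if "k \<in> set (initial_customers cs)" for k
    using that by (auto simp: initial_customers_def)
  ultimately show ?thesis
    by (auto simp: coupled_def redundancy_start_def fold_redundancy_arrive)
qed

section \<open>Sojourn times as functionals of the customers present\<close>

lemma arrival_time_nonneg: "0 \<le> arrival_time n k"
  by (cases k) (auto intro: Inf_greatest)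

text \<open>Arrival times are nonnegative, so the infimum defining the departure time ranges over
  nonnegative times only.\<close>

lemma sojourn_time_cong:
  assumes "\<And>t. t \<ge> 0 \<Longrightarrow> p t = q t"
  shows "sojourn_time n p k = sojourn_time n q k"
proof -
  have "arrival_time n k \<le> ereal t \<and> k \<notin> p t \<longleftrightarrow> arrival_time n k \<le> ereal t \<and> k \<notin> q t" for t
    using assms[of t] order_trans[OF arrival_time_nonneg[of n k], of "ereal t"] by auto
  then show ?thesis
    by (simp add: sojourn_time_def departure_time_def)
qed

section \<open>Almost sure properties of the driving streams\<close>

lemma finite_UNIV_source: "finite (UNIV :: ('c::finite, 's::finite) source set)"
proof -
  have "e \<in> range Customer \<union> range Server" for e :: "('c, 's) source"
    by (cases e) auto
  then show ?thesis
    by (intro finite_subset[of UNIV "range Customer \<union> range Server"]) auto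
qed

text \<open>Gathers what the pathwise argument needs outside one null set: finitely many streams and
  countably many horizons. The horizons \<open>Suc m\<close> are positive, as the grid lemma
  requires, and unbounded.\<close>

lemma poisson_streams_AE_regular:
  fixes N :: "('c::finite, 's::finite) source \<Rightarrow> real \<Rightarrow> 'w \<Rightarrow> nat"
  assumes "prob_space M" and rates: "\<And>c. lam c > 0" "\<And>s. mu s > 0"
    and streams: "poisson_streams M lam mu N"
  shows "AE \<omega> in M. (\<forall>e. mono_on {0..} (\<lambda>t. N e t \<omega>)) \<and>
      (\<forall>e. \<forall>t\<ge>0. continuous (at_right t) (\<lambda>u. N e u \<omega>)) \<and>
      (\<forall>m. \<exists>h K. h > 0 \<and> real K * h = real (Suc m) \<and>
        (\<forall>i<K. at_most_one_event (\<lambda>e t. N e t \<omega>) (real i * h) (real (Suc i) * h)))"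
proof -
  \<comment> \<open>\<open>case_source lam mu\<close> merges customer and server rates into one
    family over all streams.\<close>
  have N: "poisson_process M (case_source lam mu e) (N e)" for e
    using streams by (cases e) (auto simp: poisson_streams_def)
  have r: "case_source lam mu e > 0" for e
    using rates by (cases e) auto
  have "AE \<omega> in M. mono_on {0..} (\<lambda>t. N e t \<omega>) \<and>
      (\<forall>t\<ge>0. continuous (at_right t) (\<lambda>u. N e u \<omega>))" for e
  proof -
    have "AE \<omega> in M. N e 0 \<omega> = 0 \<and> mono_on {0..} (\<lambda>t. N e t \<omega>) \<and>
        (\<forall>t\<ge>0. continuous (at_right t) (\<lambda>u. N e u \<omega>))"
      using N[of e] unfolding poisson_process_def by blast
    then show ?thesis
      by eventually_elim blast
  qed
  then have "\<forall>e\<in>UNIV. AE \<omega> in M. mono_on {0..} (\<lambda>t. N e t \<omega>) \<and>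
      (\<forall>t\<ge>0. continuous (at_right t) (\<lambda>u. N e u \<omega>))"
    by blast
  then have "AE \<omega> in M. \<forall>e\<in>UNIV. mono_on {0..} (\<lambda>t. N e t \<omega>) \<and>
      (\<forall>t\<ge>0. continuous (at_right t) (\<lambda>u. N e u \<omega>))"
    by (intro AE_finite_allI finite_UNIV_source) blast
  moreover have "AE \<omega> in M. \<forall>m. \<exists>h K. h > 0 \<and> real K * h = real (Suc m) \<and>
      (\<forall>i<K. at_most_one_event (\<lambda>e t. N e t \<omega>) (real i * h) (real (Suc i) * h))"
    using AE_grid_separates_events[where N = N, OF assms(1) finite_UNIV_source N r] streams
    by (simp add: AE_all_countable poisson_streams_def del: of_nat_Suc)
  ultimately show ?thesis
    by eventually_elim blast
qed

theorem theorem3p1: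
  fixes M :: "'w measure"
    and E :: "('s::finite \<times> 'c::finite) set"
    and lam :: "'c \<Rightarrow> real" and mu :: "'s \<Rightarrow> real"
    and N :: "('c, 's) source \<Rightarrow> real \<Rightarrow> 'w \<Rightarrow> nat"
    and R :: "real \<Rightarrow> 'w \<Rightarrow> ('c, 's) redundancy_state"
    and Q :: "real \<Rightarrow> 'w \<Rightarrow> 'c customer list"
  assumes "prob_space M"
    and "\<And>c. lam c > 0" and "\<And>s. mu s > 0"
    and "poisson_streams M lam mu N"
    and "redundancy_system M E N R"
    and "matching_queue M E N Q"
    and "AE \<omega> in M. redundancy_types (R 0 \<omega>) = matching_types (Q 0 \<omega>)"
  shows "(AE \<omega> in M. \<forall>t\<ge>0. redundancy_types (R t \<omega>) = matching_types (Q t \<omega>)) \<and>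
    (AE \<omega> in M. \<forall>k.
       sojourn_time (\<lambda>e t. N e t \<omega>) (\<lambda>t. set (present (R t \<omega>))) k =
       sojourn_time (\<lambda>e t. N e t \<omega>) (\<lambda>t. set (Q t \<omega>)) k)"
proof -
  \<comment> \<open>The lists agree with identities and not only in types; sojourn times of
    individual customers require this.\<close>
  have "AE \<omega> in M. \<forall>t\<ge>0. present (R t \<omega>) = Q t \<omega>"
    using poisson_streams_AE_regular[OF assms(1-4)] assms(5)[unfolded redundancy_system_def]
      assms(6)[unfolded matching_queue_def] assms(7)
  proof eventually_elim
    case (elim \<omega>)
    define n where "n = (\<lambda>e t. N e t \<omega>)"
    define step where "step = (\<lambda>e m. map_prod (redundancy_step E e m) (matching_step E e m))"
    have follows: "follows n step (\<lambda>t. (R t \<omega>, Q t \<omega>))"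
      unfolding step_def n_def using elim by (intro follows_pair) auto
    \<comment> \<open>Equal initial types mean that both initial states are built from the same
      list.\<close>
    have start: "coupled E (\<lambda>e. n e 0) (R 0 \<omega>, Q 0 \<omega>)"
      using coupled_start elim by metis
    have step: "coupled E (c(e := Suc (c e))) (step e (Suc (c e)) y)" if "coupled E c y" for c e y
      using that coupled_step unfolding step_def by (cases y) auto
    show ?case
    proof (intro allI impI)
      fix t :: real assume t: "t \<ge> 0"
      obtain m where "t \<le> real m"
        using real_arch_simple by blast
      then have "t \<le> real (Suc m)"
        by simp
      moreover obtain h K where "h > 0" "real K * h = real (Suc m)"
        "\<And>i. i < K \<Longrightarrow> at_most_one_event n (real i * h) (real (Suc i) * h)"
        using elim unfolding n_def by blast
      ultimately have "coupled E (\<lambda>e. n e t) (R t \<omega>, Q t \<omega>)"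
        using follows_invariant[where n = n and I = "coupled E" and h = h and K = K and t = t,
            OF follows _ _ step] start t elim
        unfolding n_def by auto
      then show "present (R t \<omega>) = Q t \<omega>"
        by (simp add: coupled_def)
    qed
  qed
  then have "AE \<omega> in M. (\<forall>t\<ge>0. redundancy_types (R t \<omega>) = matching_types (Q t \<omega>)) \<and>
    (\<forall>k. sojourn_time (\<lambda>e t. N e t \<omega>) (\<lambda>t. set (present (R t \<omega>))) k =
       sojourn_time (\<lambda>e t. N e t \<omega>) (\<lambda>t. set (Q t \<omega>)) k)"
    by eventually_elim (auto simp: redundancy_types_def matching_types_def intro!: sojourn_time_cong)
  then show ?thesis
    by simp
qed

end
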